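(* Let $(\Omega,\mathcal{F},\mathsf{P})$ be a complete probability space and let $(\mathcal{F}_n)_{n\in\mathbb{N}}$ be a filtration of $\mathcal{F}$. Let $(\alpha_n)_{n\in\mathbb{N}}$ be a sequence of $]0,+\infty[$-valued random variables adapted to $(\mathcal{F}_n)_{n\in\mathbb{N}}$ such that $\sum_{n\in\mathbb{N}}\alpha_n=+\infty$ $\mathsf{P}$-a.s., and define, for every $n\in\mathbb{N}$, $\theta_n=\sum_{k=0}^n\alpha_k$. Let $(\xi_n)_{n\in\mathbb{N}}$, $(\delta_n)_{n\in\mathbb{N}}$, and $(\varepsilon_n)_{n\in\mathbb{N}}$ be sequences of $[0,+\infty[$-valued random variables adapted to $(\mathcal{F}_n)_{n\in\mathbb{N}}$, with $\sum_{n\in\mathbb{N}}\delta_n<+\infty$ $\mathsf{P}$-a.s. Suppose that $$(\forall n\in\mathbb{N})\quad \mathsf{E}(\xi_{n+1}\mid\mathcal{F}_n)\leq(1+\delta_n)\xi_n+\varepsilon_n\quad\mathsf{P}\text{-a.s.}$$ and that $\sum_{n\in\mathbb{N}}\theta_n\varepsilon_n<+\infty$ $\mathsf{P}$-a.s. Then the following hold: (i) Suppose that $\sum_{n\in\mathbb{N}}\alpha_n\xi_n<+\infty$ $\mathsf{P}$-a.s. Then $\xi_{n+1}=\mathrm{o}(1/\theta_n)$ $\mathsf{P}$-a.s. (ii) Suppose that $\sum_{n\in\mathbb{N}}\mathsf{E}(\alpha_{n+1}\xi_{n+1}\mid\mathcal{F}_n)<+\infty$ $\mathsf{P}$-a.s.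 Then $\xi_n=\mathrm{o}(1/\theta_n)$ $\mathsf{P}$-a.s. (iii) Suppose that $\sum_{n\in\mathbb{N}}\mathsf{E}(\theta_n\varepsilon_n)<+\infty$, $\sum_{n\in\mathbb{N}}\mathsf{E}(\alpha_n\xi_n)<+\infty$, $\sum_{n\in\mathbb{N}}\mathsf{E}\delta_n<+\infty$, and, for every $n\in\mathbb{N}$, $\delta_n$ is independent of $(\xi_n,\theta_n)$. Then $\xi_n=\mathrm{o}(1/\theta_n)$ $\mathsf{P}$-a.s. and $\mathsf{E}\sqrt{\xi_n\theta_n}\to 0$.
   Context: A sequence $(\alpha_n)_{n\in\mathbb{N}}$ is adapted to $(\mathcal{F}_n)_{n\in\mathbb{N}}$ if, for every $n$, $\alpha_n$ is $\mathcal{F}_n$-measurable. For nonnegative sequences of random variables, "$u_n=\mathrm{o}(1/v_n)$ $\mathsf{P}$-a.s." means $u_nv_n\to 0$ $\mathsf{P}$-a.s. as $n\to+\infty$. Conditional expectations of nonnegative random variables are $[0,+\infty]$-valued. $\mathbb{N}=\{0,1,2,\ldots\}$. *)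

theory Defs
  imports "HOL-Probability.Probability"
begin

text \<open>
  The library constant \<open>prob_space.indep_var\<close> requires both random variables to have the same
  value type. This is its defining property (see \<open>prob_space.indep_var_eq\<close>), for random
  variables with possibly different value types, such as a real number and a pair of real numbers.
\<close>

definition indep_rv ::
  "'a measure \<Rightarrow> 'b measure \<Rightarrow> ('a \<Rightarrow> 'b) \<Rightarrow> 'c measure \<Rightarrow> ('a \<Rightarrow> 'c) \<Rightarrow> bool"
where
  "indep_rv M S X T Y \<longleftrightarrow>
     X \<in> measurable M S \<and> Y \<in> measurable M T \<and>
     prob_space.indep_set M
       (sigma_sets (space M) {X -` A \<inter> space M | A. A \<in> sets S})
       (sigma_sets (space M) {Y -` A \<inter> space M | A. A \<in> sets T})"

definition ae_little_o_inverse ::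
  "'a measure \<Rightarrow> (nat \<Rightarrow> 'a \<Rightarrow> real) \<Rightarrow> (nat \<Rightarrow> 'a \<Rightarrow> real) \<Rightarrow> bool"
where
  "ae_little_o_inverse M u v \<longleftrightarrow> (AE \<omega> in M. (\<lambda>n. u n \<omega> * v n \<omega>) \<longlonglongrightarrow> 0)"

end

theory Submission
  imports Defs
begin

text \<open>
  Abel--Dini: since \<open>\<theta>\<close> consists of the partial sums of the divergent series of \<open>\<alpha>\<close>, summability of
  \<open>\<alpha> n * \<xi> n\<close> forces \<open>\<theta> n * \<xi> n\<close> to be arbitrarily small infinitely often. On the other hand,
  \<open>\<theta> n * \<xi> n\<close> (for part (i), \<open>\<theta> (n - 1) * \<xi> n\<close>) is an almost supermartingale with summable
  perturbations. No martingale convergence theorem is needed for such a process: each time it falls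
  below \<open>c\<close>, the maximal inequality bounds by \<open>2 * c / l\<close> the probability that it later exceeds \<open>l\<close>, and
  \<open>c\<close> is arbitrary, so the process tends to 0. For part (ii), summability of the conditional expectations
  of \<open>\<alpha> (n + 1) * \<xi> (n + 1)\<close> implies that of the variables. For part (iii), integrating gives part (ii)'s
  hypothesis, and independence bounds the expectations of \<open>\<xi> n * \<theta> n\<close>, so their square roots are
  uniformly integrable.
\<close>

section \<open>Deterministic facts on series and recurrences\<close>

text \<open>If the total \<open>s\<close> exceeds \<open>c\<close>, finiteness gives
  \<open>s - c < s\<close>, so some partial sum passes \<open>s - c\<close> and at most
  \<open>c\<close> is left for the tail.\<close>

lemma ennreal_suminf_tail_le:
  fixes f :: "nat \<Rightarrow> ennreal" and c :: real
  assumes fin: "(\<Sum>k. f k) < \<infinity>" and "0 < c"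
  shows "\<exists>m. (\<Sum>k. f (k + m)) \<le> ennreal c"
proof (cases "(\<Sum>k. f k) \<le> ennreal c")
  case True
  then show ?thesis by (intro exI[of _ 0]) simp
next
  case False
  let ?s = "\<Sum>k. f k"
  have "?s - ennreal c < ?s"
    using False fin \<open>0 < c\<close> by (intro ennreal_between) (auto simp: not_le intro: le_less_trans[rotated])
  then obtain m where m: "?s - ennreal c < (\<Sum>k<m. f k)"
    unfolding suminf_eq_SUP less_SUP_iff by blast
  have s: "?s = (\<Sum>k. f (k + m)) + (\<Sum>k<m. f k)"
    by (rule suminf_offset) auto
  have fin': "(\<Sum>k<m. f k) < \<infinity>"
    using s fin by (auto simp: less_top[symmetric])
  have "?s \<le> ennreal c + (\<Sum>k<m. f k)"
    using m by (meson ennreal_minus_le_iff less_imp_le)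
  then show ?thesis
    using fin' unfolding s by (auto simp: less_top[symmetric] intro!: exI[of _ m])
qed

text \<open>Otherwise \<open>x k\<close> exceeds \<open>c / t k\<close> from \<open>m\<close> on,
  where \<open>t\<close> denotes the partial sums of \<open>a\<close>. On a block after
  \<open>N\<close> along which \<open>t\<close> doubles, the sum of \<open>a k * x k\<close> is then
  at least \<open>c / 2\<close>, while the Cauchy criterion puts it below
  \<open>c / 2\<close>.\<close>

lemma weighted_sum_finite_imp_frequently_small:
  fixes a x :: "nat \<Rightarrow> real" and c :: real
  assumes a: "\<And>n. 0 < a n" and x: "\<And>n. 0 \<le> x n"
    and diverges: "(\<Sum>n. ennreal (a n)) = \<infinity>"
    and fin: "(\<Sum>n. ennreal (a n * x n)) < \<infinity>"
    and c: "0 < c"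
  shows "\<exists>n\<ge>m. (\<Sum>k\<le>n. a k) * x n \<le> c"
proof (rule ccontr)
  assume "\<not> ?thesis"
  then have big: "c < (\<Sum>k\<le>n. a k) * x n" if "m \<le> n" for n
    using that by (meson not_le)
  let ?t = "\<lambda>n. \<Sum>k\<le>n. a k"
  have tpos: "0 < ?t n" for n
    using a by (intro sum_pos) auto
  have tmono: "?t n \<le> ?t q" if "n \<le> q" for n q
    using that a by (intro sum_mono2) (auto intro: less_imp_le)
  have summ: "summable (\<lambda>n. a n * x n)"
    using fin a x by (intro summable_suminf_not_top) (auto simp: less_imp_le less_top)
  obtain N0 where N0: "\<And>N q. N \<ge> N0 \<Longrightarrow> norm (\<Sum>k=N..<q. a k * x k) < c / 2"
    using summ[unfolded summable_Cauchy, rule_format, of "c / 2"] c by auto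
  \<comment> \<open>Beyond \<open>m\<close> the lower bound \<open>big\<close> is available, beyond
    \<open>N0\<close> the Cauchy bound.\<close>
  define N where "N = max m N0"
  \<comment> \<open>If the partial sums never doubled their value at \<open>N\<close>, the series of
    \<open>a\<close> would be bounded, against \<open>diverges\<close>.\<close>
  have "\<exists>q. 2 * ?t N \<le> ?t q"
  proof (rule ccontr)
    assume "\<not> ?thesis"
    then have le: "?t q \<le> 2 * ?t N" for q by (auto simp: not_le intro: less_imp_le)
    have "(\<Sum>n. ennreal (a n)) \<le> ennreal (2 * ?t N)"
    proof (rule suminf_le_const)
      fix q
      have "(\<Sum>n<q. ennreal (a n)) = ennreal (\<Sum>n<q. a n)"
        using a by (intro sum_ennreal) (auto intro: less_imp_le)
      also have "\<dots> \<le> ennreal (?t q)"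
        using a by (intro ennreal_leI sum_mono2) (auto intro: less_imp_le)
      also have "\<dots> \<le> ennreal (2 * ?t N)"
        by (intro ennreal_leI le)
      finally show "(\<Sum>n<q. ennreal (a n)) \<le> ennreal (2 * ?t N)" .
    qed simp
    then show False using diverges by (simp add: top_unique)
  qed
  then obtain q where q: "2 * ?t N \<le> ?t q" by blast
  have "N < q"
    using q tpos[of N] tmono[of q N] by (cases "N < q") auto
  have diff: "?t q - ?t N = (\<Sum>k=Suc N..<Suc q. a k)"
  proof -
    have "{..q} = {..N} \<union> {Suc N..<Suc q}" using \<open>N < q\<close> by auto
    moreover have "sum a ({..N} \<union> {Suc N..<Suc q}) = ?t N + (\<Sum>k=Suc N..<Suc q. a k)"
      by (rule sum.union_disjoint) auto
    ultimately have "?t q = ?t N + (\<Sum>k=Suc N..<Suc q. a k)"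
      by metis
    then show ?thesis by linarith
  qed
  \<comment> \<open>Replacing \<open>?t k\<close> by the larger \<open>?t q\<close> makes the lower
    bound on \<open>x k\<close> uniform over the block.\<close>
  have "c / ?t q * (\<Sum>k=Suc N..<Suc q. a k) \<le> (\<Sum>k=Suc N..<Suc q. a k * x k)"
    unfolding sum_distrib_left
  proof (rule sum_mono)
    fix k assume k: "k \<in> {Suc N..<Suc q}"
    have "c < ?t k * x k" using k by (intro big) (auto simp: N_def)
    also have "\<dots> \<le> ?t q * x k" using k by (intro mult_right_mono tmono x) auto
    finally have "c / ?t q \<le> x k" using tpos[of q] by (simp add: field_simps)
    then have "c / ?t q * a k \<le> x k * a k"
      using a[of k] by (intro mult_right_mono) auto
    then show "c / ?t q * a k \<le> a k * x k"
      by (simp only: mult.commute[of "x k"])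
  qed
  moreover have "norm (\<Sum>k=Suc N..<Suc q. a k * x k) < c / 2"
    by (intro N0) (auto simp: N_def)
  moreover have "c / 2 \<le> c / ?t q * (?t q - ?t N)"
  proof -
    have "?t q / 2 \<le> ?t q - ?t N" using q by simp
    then have "c / ?t q * (?t q / 2) \<le> c / ?t q * (?t q - ?t N)"
      using c tpos[of q] by (intro mult_left_mono) auto
    then show ?thesis using tpos[of q] by simp
  qed
  ultimately show False
    unfolding diff real_norm_def by linarith
qed

text \<open>All factors \<open>1 + d k\<close> are at least 1, so unrolling the recurrence bounds
  \<open>p n\<close> by their product times \<open>p 0 + (\<Sum>k<n. e k)\<close>; the product is
  controlled by \<open>1 + r \<le> exp r\<close>. The lemma serves to bound the expectations of
  \<open>\<xi> n * \<theta> n\<close> uniformly in \<open>n\<close>.\<close>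

lemma ennreal_affine_recurrence_bounded:
  fixes p d e :: "nat \<Rightarrow> ennreal"
  assumes step: "\<And>n. p (Suc n) \<le> (1 + d n) * p n + e n"
    and p0: "p 0 < \<infinity>" and d: "(\<Sum>n. d n) < \<infinity>" and e: "(\<Sum>n. e n) < \<infinity>"
  shows "\<exists>C\<ge>0. \<forall>n. p n \<le> ennreal C"
proof -
  have le: "p n \<le> (\<Prod>k<n. 1 + d k) * (p 0 + (\<Sum>k<n. e k))" for n
  proof (induction n)
    case (Suc n)
    let ?P = "\<Prod>k<Suc n. 1 + d k"
    have P1: "1 \<le> ?P"
      by (rule prod_ge_1) simp
    have "p (Suc n) \<le> (1 + d n) * p n + e n"
      by (rule step)
    also have "\<dots> \<le> (1 + d n) * ((\<Prod>k<n. 1 + d k) * (p 0 + (\<Sum>k<n. e k))) + ?P * e n"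
      using mult_right_mono[OF P1, of "e n"] by (intro add_mono mult_left_mono Suc.IH) auto
    also have "\<dots> = ?P * (p 0 + (\<Sum>k<Suc n. e k))"
      by (simp add: algebra_simps)
    finally show ?case .
  qed simp
  \<comment> \<open>Every \<open>d n\<close> is finite because the total is, so it can be replaced
    by a real number and compared with the exponential.\<close>
  define r where "r n = enn2real (d n)" for n
  have dn: "d n \<noteq> \<infinity>" for n
    using d sum_le_suminf[of d "{n}"] by (auto simp: top_unique)
  have dr: "d n = ennreal (r n)" and r0: "0 \<le> r n" for n
    using dn[of n] by (auto simp: r_def less_top)
  have sr: "summable r"
    using d r0 by (intro summable_suminf_not_top) (auto simp: dr)
  have prod: "(\<Prod>k<n. 1 + d k) \<le> ennreal (exp (\<Sum>k. r k))" for n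
  proof -
    have "(\<Prod>k<n. 1 + d k) = (\<Prod>k<n. ennreal (1 + r k))"
      using r0 by (simp add: dr ennreal_plus)
    also have "\<dots> = ennreal (\<Prod>k<n. 1 + r k)"
      using r0 by (intro prod_ennreal) (simp add: add_nonneg_nonneg)
    also have "\<dots> \<le> ennreal (\<Prod>k<n. exp (r k))"
      using r0 by (intro ennreal_leI prod_mono) (auto simp: add_nonneg_nonneg)
    also have "\<dots> \<le> ennreal (exp (\<Sum>k. r k))"
      using sum_le_suminf[OF sr] r0 by (intro ennreal_leI) (simp flip: exp_sum)
    finally show ?thesis .
  qed
  let ?B = "ennreal (exp (\<Sum>k. r k)) * (p 0 + (\<Sum>k. e k))"
  have "p n \<le> ?B" for n
  proof -
    have "(\<Sum>k<n. e k) \<le> (\<Sum>k. e k)"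
      by (rule sum_le_suminf) auto
    then show ?thesis
      by (intro order_trans[OF le] mult_mono prod add_left_mono) auto
  qed
  moreover have "?B < \<infinity>"
    using p0 e by (auto simp: ennreal_mult_less_top)
  ultimately show ?thesis
    by (intro exI[of _ "enn2real ?B"]) (auto simp: less_top)
qed

section \<open>Independence and uniform integrability\<close>

text \<open>Composing with a measurable function shrinks the generated sigma-algebra, so
  \<open>f (X \<omega>)\<close> and \<open>g (Y \<omega>)\<close> inherit independence. Both take
  values in \<open>ennreal\<close>, hence \<open>indep_var\<close> and its product formula apply to
  them.\<close>

lemma (in prob_space) indep_rv_nn_integral_mult:
  fixes f :: "'b \<Rightarrow> ennreal" and g :: "'c \<Rightarrow> ennreal"
  assumes indep: "indep_rv M S X T Y"
    and f: "f \<in> borel_measurable S" and g: "g \<in> borel_measurable T"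
  shows "(\<integral>\<^sup>+\<omega>. f (X \<omega>) * g (Y \<omega>) \<partial>M) = (\<integral>\<^sup>+\<omega>. f (X \<omega>) \<partial>M) * (\<integral>\<^sup>+\<omega>. g (Y \<omega>) \<partial>M)"
proof -
  have XY: "X \<in> measurable M S" "Y \<in> measurable M T"
    and ind: "indep_set (sigma_sets (space M) {X -` A \<inter> space M | A. A \<in> sets S})
       (sigma_sets (space M) {Y -` A \<inter> space M | A. A \<in> sets T})"
    using indep by (auto simp: indep_rv_def)
  have sub: "sigma_sets (space M) {(\<lambda>\<omega>. h (W \<omega>)) -` A \<inter> space M | A. A \<in> sets borel}
      \<subseteq> sigma_sets (space M) {W -` A \<inter> space M | A. A \<in> sets N}"
    if h: "h \<in> borel_measurable N" and W: "W \<in> measurable M N" for h :: "'d \<Rightarrow> ennreal" and W N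
  proof (rule sigma_sets_mono', safe)
    fix A :: "ennreal set" assume "A \<in> sets borel"
    then have "h -` A \<inter> space N \<in> sets N" using h by (rule measurable_sets[rotated])
    moreover have "(\<lambda>\<omega>. h (W \<omega>)) -` A \<inter> space M = W -` (h -` A \<inter> space N) \<inter> space M"
      using measurable_space[OF W] by auto
    ultimately show "\<exists>B. (\<lambda>\<omega>. h (W \<omega>)) -` A \<inter> space M = W -` B \<inter> space M \<and> B \<in> sets N"
      by blast
  qed
  have "indep_var borel (\<lambda>\<omega>. f (X \<omega>)) borel (\<lambda>\<omega>. g (Y \<omega>))"
    unfolding indep_var_eq
  proof (intro conjI)
    show "indep_set (sigma_sets (space M) {(\<lambda>\<omega>. f (X \<omega>)) -` A \<inter> space M | A. A \<in> sets borel})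
        (sigma_sets (space M) {(\<lambda>\<omega>. g (Y \<omega>)) -` A \<inter> space M | A. A \<in> sets borel})"
      using ind sub[OF f XY(1)] sub[OF g XY(2)] unfolding indep_sets2_eq by blast
  qed (use f g XY in \<open>auto intro: measurable_compose\<close>)
  \<comment> \<open>\<open>indep_var\<close> uses the family of spaces
    \<open>case_bool borel borel\<close>; it is rewritten to the constant family that the product
    formula expects.\<close>
  then have "indep_vars (\<lambda>_. borel) (case_bool (\<lambda>\<omega>. f (X \<omega>)) (\<lambda>\<omega>. g (Y \<omega>))) UNIV"
    unfolding indep_var_def by (rule indep_vars_cong[THEN iffD1, rotated -1]) (auto split: bool.split)
  from indep_vars_nn_integral[OF _ this] show ?thesis
    by (simp add: UNIV_bool mult.commute)
qed

text \<open>Where \<open>sqrt z\<close> exceeds \<open>K\<close> it is at most \<open>z / K\<close>,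
  so the bound on the expectations makes the part above \<open>K\<close> uniformly small. The part
  truncated at \<open>K\<close> tends to 0 by dominated convergence.\<close>

lemma (in prob_space) nn_integral_sqrt_tendsto_0:
  fixes Z :: "nat \<Rightarrow> 'a \<Rightarrow> real"
  assumes Z[measurable]: "\<And>n. Z n \<in> borel_measurable M"
    and nonneg: "\<And>n \<omega>. \<omega> \<in> space M \<Longrightarrow> 0 \<le> Z n \<omega>"
    and lim: "AE \<omega> in M. (\<lambda>n. Z n \<omega>) \<longlonglongrightarrow> 0"
    and C: "0 \<le> C" "\<And>n. (\<integral>\<^sup>+\<omega>. ennreal (Z n \<omega>) \<partial>M) \<le> ennreal C"
  shows "(\<lambda>n. \<integral>\<^sup>+\<omega>. ennreal (sqrt (Z n \<omega>)) \<partial>M) \<longlonglongrightarrow> 0"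
proof (rule order_tendstoI)
  fix e :: ennreal assume "0 < e"
  then obtain r where r: "0 < r" "ennreal r \<le> e"
    by (metis ennreal_0 ennreal_less_iff ennreal_less_zero_iff dense ennreal_cases less_imp_le linorder_not_less top.not_eq_extremum zero_less_one)
  \<comment> \<open>This makes \<open>C / K\<close> less than \<open>r / 2\<close>; using
    \<open>C + 1\<close> keeps \<open>K\<close> positive when \<open>C\<close> is 0.\<close>
  define K where "K = 2 * (C + 1) / r"
  have K: "0 < K" "C / K < r / 2"
    using r C by (auto simp: K_def field_simps)
  have split: "(\<integral>\<^sup>+\<omega>. ennreal (sqrt (Z n \<omega>)) \<partial>M)
      \<le> (\<integral>\<^sup>+\<omega>. ennreal (min (sqrt (Z n \<omega>)) K) \<partial>M) + ennreal (C / K)" for n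
  proof -
    have "(\<integral>\<^sup>+\<omega>. ennreal (sqrt (Z n \<omega>)) \<partial>M)
        \<le> (\<integral>\<^sup>+\<omega>. ennreal (min (sqrt (Z n \<omega>)) K) + ennreal (1 / K) * ennreal (Z n \<omega>) \<partial>M)"
    proof (rule nn_integral_mono)
      fix \<omega> assume \<omega>: "\<omega> \<in> space M"
      have "sqrt (Z n \<omega>) \<le> min (sqrt (Z n \<omega>)) K + 1 / K * Z n \<omega>"
      proof (cases "sqrt (Z n \<omega>) \<le> K")
        case False
        then have "K * sqrt (Z n \<omega>) \<le> sqrt (Z n \<omega>) * sqrt (Z n \<omega>)"
          using nonneg[OF \<omega>, of n] by (intro mult_right_mono) auto
        then have "sqrt (Z n \<omega>) \<le> 1 / K * Z n \<omega>"
          using K nonneg[OF \<omega>, of n] by (simp add: field_simps)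
        then show ?thesis using False K by simp
      qed (use nonneg[OF \<omega>, of n] K in auto)
      then show "ennreal (sqrt (Z n \<omega>)) \<le> ennreal (min (sqrt (Z n \<omega>)) K) + ennreal (1 / K) * ennreal (Z n \<omega>)"
        using nonneg[OF \<omega>, of n] K by (simp add: ennreal_leI flip: ennreal_mult ennreal_plus)
    qed
    also have "\<dots> = (\<integral>\<^sup>+\<omega>. ennreal (min (sqrt (Z n \<omega>)) K) \<partial>M)
        + ennreal (1 / K) * (\<integral>\<^sup>+\<omega>. ennreal (Z n \<omega>) \<partial>M)"
      by (simp add: nn_integral_add nn_integral_cmult)
    also have "\<dots> \<le> (\<integral>\<^sup>+\<omega>. ennreal (min (sqrt (Z n \<omega>)) K) \<partial>M) + ennreal (1 / K) * ennreal C"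
      by (intro add_left_mono mult_left_mono C) simp
    also have "ennreal (1 / K) * ennreal C = ennreal (C / K)"
      using K C by (simp flip: ennreal_mult)
    finally show ?thesis .
  qed
  have "(\<lambda>n. \<integral>\<^sup>+\<omega>. ennreal (min (sqrt (Z n \<omega>)) K) \<partial>M) \<longlonglongrightarrow> (\<integral>\<^sup>+\<omega>. 0 \<partial>M)"
  proof (rule nn_integral_dominated_convergence[where w="\<lambda>_. ennreal K"])
    show "(\<integral>\<^sup>+\<omega>. ennreal K \<partial>M) < \<infinity>"
      by (simp add: emeasure_space_1)
    show "AE \<omega> in M. (\<lambda>n. ennreal (min (sqrt (Z n \<omega>)) K)) \<longlonglongrightarrow> 0"
      using lim
    proof eventually_elim
      case (elim \<omega>)
      have "(\<lambda>n. ennreal (min (sqrt (Z n \<omega>)) K)) \<longlonglongrightarrow> ennreal (min (sqrt 0) K)"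
        by (intro tendsto_intros elim)
      then show ?case using K by (simp add: min_def)
    qed
  qed (auto intro!: ennreal_leI)
  then have "\<forall>\<^sub>F n in sequentially. (\<integral>\<^sup>+\<omega>. ennreal (min (sqrt (Z n \<omega>)) K) \<partial>M) < ennreal (r / 2)"
    using r by (intro order_tendstoD) auto
  then show "\<forall>\<^sub>F n in sequentially. (\<integral>\<^sup>+\<omega>. ennreal (sqrt (Z n \<omega>)) \<partial>M) < e"
  proof eventually_elim
    case (elim n)
    have "(\<integral>\<^sup>+\<omega>. ennreal (sqrt (Z n \<omega>)) \<partial>M)
      \<le> (\<integral>\<^sup>+\<omega>. ennreal (min (sqrt (Z n \<omega>)) K) \<partial>M) + ennreal (C / K)"
      by (rule split)
    also have "\<dots> < ennreal (r / 2) + ennreal (r / 2)"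
      using elim K r by (intro add_strict_mono) (auto simp: ennreal_less_iff C)
    also have "\<dots> = ennreal r"
      using r by (simp flip: ennreal_plus)
    finally show ?case using r by simp
  qed
qed simp

section \<open>Filtrations and a maximal inequality\<close>

text \<open>\<open>filtration\<close> fixes the common space and the monotonicity of
  \<open>F\<close>; \<open>subalgebra_F\<close> places every \<open>F n\<close> inside
  \<open>M\<close>, which gives conditional expectations with respect to \<open>F n\<close> their
  meaning.\<close>

locale filtered_prob_space = prob_space M + filtration "space M" F
  for M :: "'a measure" and F :: "nat \<Rightarrow> 'a measure" +
  assumes subalgebra_F: "subalgebra M (F n)"
begin

lemma sigma_finite_F: "sigma_finite_subalgebra M (F n)"
  by (intro finite_measure_subalgebra_is_sigma_finite finite_measure_subalgebra.intro
      finite_measure_subalgebra_axioms.intro subalgebra_F finite_measure_axioms)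

lemma measurable_F_imp_M: "f \<in> measurable (F n) N \<Longrightarrow> f \<in> measurable M N"
  by (rule measurable_from_subalg[OF subalgebra_F])

lemma measurable_F_mono: "f \<in> measurable (F m) N \<Longrightarrow> m \<le> n \<Longrightarrow> f \<in> measurable (F n) N"
  using sets_F_mono[of m n] space_F by (auto simp: measurable_def)

lemma sets_F_imp_M: "A \<in> sets (F n) \<Longrightarrow> A \<in> sets M"
  using subalgebra_F[of n] by (auto simp: subalgebra_def)

text \<open>
  The drift condition is only required below the level \<open>l\<close>; hence a multiplicative perturbation
  \<open>D n * Z n\<close> can be absorbed into the additive one \<open>\<zeta> n\<close> as \<open>l * D n\<close>.
\<close>

lemma maximal_inequality_after:
  fixes Z \<zeta> :: "nat \<Rightarrow> 'a \<Rightarrow> ennreal" and c l :: real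
  assumes Z: "\<And>n. Z n \<in> borel_measurable (F n)"
    and \<zeta>: "\<And>n. \<zeta> n \<in> borel_measurable (F n)"
    and drift: "\<And>n. AE \<omega> in M. Z n \<omega> < ennreal l \<longrightarrow>
                  nn_cond_exp M (F n) (Z (Suc n)) \<omega> \<le> Z n \<omega> + \<zeta> n \<omega>"
    and A: "A \<in> sets (F j)" and ZA: "\<And>\<omega>. \<omega> \<in> A \<Longrightarrow> Z j \<omega> \<le> ennreal c"
    and c: "0 < c" "c < l"
  shows "ennreal l * emeasure M {\<omega>\<in>A. (\<exists>n\<ge>j. ennreal l \<le> Z n \<omega>) \<and> (\<Sum>k. \<zeta> (j + k) \<omega>) \<le> ennreal c}
           \<le> ennreal (2 * c) * emeasure M A"
proof -
  \<comment> \<open>On \<open>G i\<close> the process has stayed below \<open>l\<close>, and the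
    perturbations within \<open>c\<close>, from time \<open>j\<close> to \<open>j + i\<close>; on
    \<open>H i\<close> the level \<open>l\<close> is then reached at time \<open>j + i + 1\<close>.
    The sum includes \<open>\<zeta> (j + i)\<close>, known at time \<open>j + i\<close>, so
    \<open>G i\<close> belongs to \<open>F (j + i)\<close>.\<close>
  define G where "G i = {\<omega>\<in>A. (\<forall>k\<le>i. Z (j + k) \<omega> < ennreal l) \<and> (\<Sum>k\<le>i. \<zeta> (j + k) \<omega>) \<le> ennreal c}" for i
  define H where "H i = {\<omega>\<in>G i. ennreal l \<le> Z (j + Suc i) \<omega>}" for i
  have AM[measurable]: "A \<in> sets M"
    by (rule sets_F_imp_M[OF A])
  have [measurable]: "Z n \<in> borel_measurable M" "\<zeta> n \<in> borel_measurable M" for n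
    using measurable_F_imp_M Z \<zeta> by blast+
  have GF: "G i \<in> sets (F (j + i))" for i
  proof -
    have [measurable]: "Z (j + k) \<in> borel_measurable (F (j + i))" "\<zeta> (j + k) \<in> borel_measurable (F (j + i))"
      if "k \<le> i" for k
      using that by (auto intro!: measurable_F_mono[OF Z] measurable_F_mono[OF \<zeta>])
    have [measurable]: "A \<in> sets (F (j + i))"
      using A sets_F_mono[of j "j + i"] by auto
    have "G i = {\<omega>\<in>space (F (j + i)). \<omega> \<in> A \<and> (\<forall>k\<in>{..i}. Z (j + k) \<omega> < ennreal l) \<and>
        (\<Sum>k\<in>{..i}. \<zeta> (j + k) \<omega>) \<le> ennreal c}"
      unfolding G_def using sets.sets_into_space[OF A] by (auto simp: space_F)
    also have "\<dots> \<in> sets (F (j + i))"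
      by measurable
    finally show ?thesis .
  qed
  have GM[measurable]: "G i \<in> sets M" for i
    using GF sets_F_imp_M by blast
  have HM[measurable]: "H i \<in> sets M" for i
  proof -
    have "H i = {\<omega>\<in>space M. \<omega> \<in> G i \<and> ennreal l \<le> Z (j + Suc i) \<omega>}"
      unfolding H_def using sets.sets_into_space[OF GM[of i]] by auto
    also have "\<dots> \<in> sets M" by measurable
    finally show ?thesis .
  qed
  define a where "a i = (\<integral>\<^sup>+\<omega>. indicator (G i) \<omega> * Z (j + i) \<omega> \<partial>M)" for i
  define e where "e i = (\<integral>\<^sup>+\<omega>. indicator (G i) \<omega> * \<zeta> (j + i) \<omega> \<partial>M)" for i
  \<comment> \<open>\<open>G (Suc i)\<close> and \<open>H i\<close> are disjoint parts of
    \<open>G i\<close>, and on \<open>H i\<close> the new value is at least \<open>l\<close>. Since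
    \<open>G i\<close> is known at time \<open>j + i\<close>, the new value may be replaced by its
    conditional expectation, to which the drift applies because \<open>Z (j + i)\<close> is below
    \<open>l\<close> on \<open>G i\<close>.\<close>
  have step: "a (Suc i) + ennreal l * emeasure M (H i) \<le> a i + e i" for i
  proof -
    interpret sigma_finite_subalgebra M "F (j + i)"
      by (rule sigma_finite_F)
    have "a (Suc i) + ennreal l * emeasure M (H i)
        = (\<integral>\<^sup>+\<omega>. indicator (G (Suc i)) \<omega> * Z (j + Suc i) \<omega> + ennreal l * indicator (H i) \<omega> \<partial>M)"
      unfolding a_def by (subst nn_integral_add) (auto simp: nn_integral_cmult)
    also have "\<dots> \<le> (\<integral>\<^sup>+\<omega>. indicator (G i) \<omega> * Z (j + Suc i) \<omega> \<partial>M)"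
    proof (rule nn_integral_mono)
      fix \<omega>
      have "\<omega> \<in> G i" if *: "\<omega> \<in> G (Suc i)"
        using * unfolding G_def by (auto intro: order_trans[rotated])
      moreover have "\<omega> \<notin> H i" if *: "\<omega> \<in> G (Suc i)"
        using * unfolding G_def H_def by (auto simp: not_le)
      ultimately show "indicator (G (Suc i)) \<omega> * Z (j + Suc i) \<omega> + ennreal l * indicator (H i) \<omega>
          \<le> indicator (G i) \<omega> * Z (j + Suc i) \<omega>"
        by (auto simp: indicator_def H_def)
    qed
    also have "\<dots> = (\<integral>\<^sup>+\<omega>. indicator (G i) \<omega> * nn_cond_exp M (F (j + i)) (Z (j + Suc i)) \<omega> \<partial>M)"
      using GF by (intro nn_cond_exp_intg[symmetric]) auto
    also have "\<dots> \<le> (\<integral>\<^sup>+\<omega>. indicator (G i) \<omega> * Z (j + i) \<omega> + indicator (G i) \<omega> * \<zeta> (j + i) \<omega> \<partial>M)"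
      using drift[of "j + i"]
      by (intro nn_integral_mono_AE) (auto simp: indicator_def G_def)
    also have "\<dots> = a i + e i"
      unfolding a_def e_def by (rule nn_integral_add) auto
    finally show ?thesis .
  qed
  \<comment> \<open>The steps telescope; the additive form avoids the truncated subtraction of
    \<open>ennreal\<close>.\<close>
  have sum: "a N + ennreal l * (\<Sum>i<N. emeasure M (H i)) \<le> a 0 + (\<Sum>i<N. e i)" for N
  proof (induction N)
    case (Suc N)
    have "a (Suc N) + ennreal l * (\<Sum>i<Suc N. emeasure M (H i))
       = (a (Suc N) + ennreal l * emeasure M (H N)) + ennreal l * (\<Sum>i<N. emeasure M (H i))"
      by (simp add: algebra_simps)
    also have "\<dots> \<le> (a N + e N) + ennreal l * (\<Sum>i<N. emeasure M (H i))"
      by (intro add_right_mono step)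
    also have "\<dots> = (a N + ennreal l * (\<Sum>i<N. emeasure M (H i))) + e N"
      by (simp add: algebra_simps)
    also have "\<dots> \<le> (a 0 + (\<Sum>i<N. e i)) + e N"
      by (intro add_right_mono Suc.IH)
    finally show ?case by (simp add: algebra_simps)
  qed simp
  have a0: "a 0 \<le> ennreal c * emeasure M A"
  proof -
    have "a 0 \<le> (\<integral>\<^sup>+\<omega>. ennreal c * indicator A \<omega> \<partial>M)"
      unfolding a_def by (intro nn_integral_mono) (auto simp: indicator_def G_def ZA)
    then show ?thesis by (simp add: nn_integral_cmult)
  qed
  have esum: "(\<Sum>i<N. e i) \<le> ennreal c * emeasure M A" for N
  proof -
    have "(\<Sum>i<N. e i) = (\<integral>\<^sup>+\<omega>. (\<Sum>i<N. indicator (G i) \<omega> * \<zeta> (j + i) \<omega>) \<partial>M)"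
      unfolding e_def by (rule nn_integral_sum[symmetric]) auto
    also have "\<dots> \<le> (\<integral>\<^sup>+\<omega>. ennreal c * indicator A \<omega> \<partial>M)"
    proof (rule nn_integral_mono)
      fix \<omega>
      \<comment> \<open>All perturbations counted at \<omega> have index at most
        \<open>Max I\<close>, and membership in \<open>G (Max I)\<close> bounds their sum by
        \<open>c\<close>.\<close>
      define I where "I = {i. i < N \<and> \<omega> \<in> G i}"
      have eq: "(\<Sum>i<N. indicator (G i) \<omega> * \<zeta> (j + i) \<omega>) = (\<Sum>i\<in>I. \<zeta> (j + i) \<omega>)"
        unfolding I_def by (intro sum.mono_neutral_cong_right) (auto simp: indicator_def)
      show "(\<Sum>i<N. indicator (G i) \<omega> * \<zeta> (j + i) \<omega>) \<le> ennreal c * indicator A \<omega>"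
      proof (cases "I = {}")
        case True
        then show ?thesis by (simp add: eq)
      next
        case False
        have fI: "finite I" by (auto simp: I_def)
        have "\<omega> \<in> G (Max I)"
          using Max_in[OF fI False] unfolding I_def by blast
        then have mI: "\<omega> \<in> A" "(\<Sum>i\<le>Max I. \<zeta> (j + i) \<omega>) \<le> ennreal c"
          unfolding G_def by blast+
        have "(\<Sum>i\<in>I. \<zeta> (j + i) \<omega>) \<le> (\<Sum>i\<le>Max I. \<zeta> (j + i) \<omega>)"
          using fI by (intro sum_mono2) auto
        also have "\<dots> \<le> ennreal c * indicator A \<omega>"
          using mI by simp
        finally show ?thesis by (simp add: eq)
      qed
    qed
    finally show ?thesis by (simp add: nn_integral_cmult)
  qed
  \<comment> \<open>The factor 2 collects one \<open>c\<close> from the starting value and one from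
    the perturbations.\<close>
  have bound: "ennreal l * (\<Sum>i<N. emeasure M (H i)) \<le> ennreal (2 * c) * emeasure M A" for N
  proof -
    have "ennreal l * (\<Sum>i<N. emeasure M (H i)) \<le> a N + ennreal l * (\<Sum>i<N. emeasure M (H i))"
      by simp
    also have "\<dots> \<le> ennreal c * emeasure M A + ennreal c * emeasure M A"
      using sum[of N] a0 esum[of N] by (meson add_mono order_trans)
    also have "\<dots> = ennreal (2 * c) * emeasure M A"
      using c by (simp add: ennreal_mult mult.assoc flip: mult_2)
    finally show ?thesis .
  qed
  have "{\<omega>\<in>A. (\<exists>n\<ge>j. ennreal l \<le> Z n \<omega>) \<and> (\<Sum>k. \<zeta> (j + k) \<omega>) \<le> ennreal c} \<subseteq> (\<Union>i. H i)"
  proof safe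
    fix \<omega> n assume \<omega>: "\<omega> \<in> A" "j \<le> n" "ennreal l \<le> Z n \<omega>" "(\<Sum>k. \<zeta> (j + k) \<omega>) \<le> ennreal c"
    \<comment> \<open>\<open>k\<close> is the first passage to level \<open>l\<close>. It is
      positive because \<open>Z j\<close> is at most \<open>c < l\<close> on \<open>A\<close>, so
      the passage is recorded by \<open>H (k - 1)\<close>.\<close>
    define k where "k = (LEAST k. ennreal l \<le> Z (j + k) \<omega>)"
    have k: "ennreal l \<le> Z (j + k) \<omega>"
      unfolding k_def by (rule LeastI[of _ "n - j"]) (use \<omega> in simp)
    have below: "Z (j + i) \<omega> < ennreal l" if "i < k" for i
      using not_less_Least[of i "\<lambda>k. ennreal l \<le> Z (j + k) \<omega>"] that by (auto simp: k_def)
    have "k \<noteq> 0"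
    proof
      assume "k = 0"
      then have "ennreal l \<le> ennreal c" using k ZA[OF \<omega>(1)] by auto
      then show False using c by (simp add: ennreal_le_iff)
    qed
    then obtain i where i: "k = Suc i" by (cases k) auto
    have "(\<Sum>k\<le>i. \<zeta> (j + k) \<omega>) \<le> (\<Sum>k. \<zeta> (j + k) \<omega>)"
      by (rule sum_le_suminf) auto
    then have "\<omega> \<in> H i"
      unfolding H_def G_def using \<omega> k below i by auto
    then show "\<omega> \<in> (\<Union>i. H i)" by blast
  qed
  then have "emeasure M {\<omega>\<in>A. (\<exists>n\<ge>j. ennreal l \<le> Z n \<omega>) \<and> (\<Sum>k. \<zeta> (j + k) \<omega>) \<le> ennreal c}
      \<le> emeasure M (\<Union>i. H i)"
    by (intro emeasure_mono) auto
  also have "\<dots> \<le> (\<Sum>i. emeasure M (H i))"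
    by (rule emeasure_subadditive_countably) auto
  finally have "ennreal l * emeasure M {\<omega>\<in>A. (\<exists>n\<ge>j. ennreal l \<le> Z n \<omega>) \<and> (\<Sum>k. \<zeta> (j + k) \<omega>) \<le> ennreal c}
      \<le> ennreal l * (\<Sum>i. emeasure M (H i))"
    by (rule mult_left_mono) simp
  also have "\<dots> = (\<Sum>i. ennreal l * emeasure M (H i))"
    by simp
  also have "\<dots> \<le> ennreal (2 * c) * emeasure M A"
    by (rule suminf_le_const) (use bound in \<open>auto simp: sum_distrib_left\<close>)
  finally show ?thesis .
qed

text \<open>After any time \<open>m\<close> the process falls to \<open>c\<close> or below, at a
  random first time \<open>j\<close>. Applying the previous inequality on each event that fixes
  \<open>j\<close> and summing over these disjoint events gives \<open>2 * c\<close> times a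
  probability.\<close>

lemma maximal_inequality_frequently_small:
  fixes Z \<zeta> :: "nat \<Rightarrow> 'a \<Rightarrow> ennreal" and c l :: real
  assumes Z: "\<And>n. Z n \<in> borel_measurable (F n)"
    and \<zeta>: "\<And>n. \<zeta> n \<in> borel_measurable (F n)"
    and drift: "\<And>n. AE \<omega> in M. Z n \<omega> < ennreal l \<longrightarrow>
                  nn_cond_exp M (F n) (Z (Suc n)) \<omega> \<le> Z n \<omega> + \<zeta> n \<omega>"
    and c: "0 < c" "c < l"
  shows "ennreal l * emeasure M {\<omega>\<in>space M. (\<forall>m. \<exists>n\<ge>m. ennreal l \<le> Z n \<omega>) \<and>
             (\<forall>m. \<exists>n\<ge>m. Z n \<omega> \<le> ennreal c) \<and> (\<Sum>k. \<zeta> k \<omega>) < \<infinity>}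
           \<le> ennreal (2 * c)" (is "_ * emeasure M ?L \<le> _")
proof -
  have [measurable]: "Z n \<in> borel_measurable M" "\<zeta> n \<in> borel_measurable M" for n
    using measurable_F_imp_M Z \<zeta> by blast+
  \<comment> \<open>Asking only the tail from \<open>m\<close> on to be at most \<open>c\<close>
    makes \<open>B m\<close> increase with \<open>m\<close>, and finiteness of the series puts every
    point of the event into some \<open>B m\<close>.\<close>
  define B where "B m = {\<omega>\<in>space M. (\<forall>m. \<exists>n\<ge>m. ennreal l \<le> Z n \<omega>) \<and>
    (\<forall>m. \<exists>n\<ge>m. Z n \<omega> \<le> ennreal c) \<and> (\<Sum>k. \<zeta> (k + m) \<omega>) \<le> ennreal c}" for m
  have [measurable]: "B m \<in> sets M" for m
    unfolding B_def by measurable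
  have tail: "(\<Sum>k. f (k + n)) \<le> (\<Sum>k. f (k + m))" if "m \<le> n" for m n and f :: "nat \<Rightarrow> ennreal"
  proof -
    have "(\<Sum>k. f (k + m)) = (\<Sum>k. f (k + (n - m) + m)) + (\<Sum>k<n - m. f (k + m))"
      by (rule suminf_offset) auto
    also have "(\<Sum>k. f (k + (n - m) + m)) = (\<Sum>k. f (k + n))"
      using that by simp
    finally show ?thesis by simp
  qed
  have "incseq B"
    unfolding B_def by (intro monoI) (auto intro: order_trans[OF tail])
  have B_le: "ennreal l * emeasure M (B m) \<le> ennreal (2 * c)" for m
  proof -
    \<comment> \<open>\<open>A j\<close> says that \<open>j\<close> is the first time from
      \<open>m\<close> on at which the process is at most \<open>c\<close>; it is decided by time
      \<open>j\<close>.\<close>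
    define A where "A j = (if m \<le> j then {\<omega>\<in>space M. Z j \<omega> \<le> ennreal c \<and> (\<forall>i\<in>{m..<j}. \<not> Z i \<omega> \<le> ennreal c)} else {})" for j
    have AF: "A j \<in> sets (F j)" for j
    proof -
      have [measurable]: "Z i \<in> borel_measurable (F j)" if "i \<le> j" for i
        using that by (rule measurable_F_mono[OF Z])
      have "{\<omega>\<in>space (F j). Z j \<omega> \<le> ennreal c \<and> (\<forall>i\<in>{m..<j}. \<not> Z i \<omega> \<le> ennreal c)} \<in> sets (F j)"
        by measurable
      then show ?thesis by (simp add: A_def space_F)
    qed
    then have [measurable]: "A j \<in> sets M" for j
      using sets_F_imp_M by blast
    have "A i \<inter> A j = {}" if "i < j" for i j
      using that unfolding A_def by (auto split: if_splits)
    then have disj: "disjoint_family A"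
      unfolding disjoint_family_on_def by (metis Int_commute linorder_neqE_nat)
    define E where "E j = {\<omega>\<in>A j. (\<exists>n\<ge>j. ennreal l \<le> Z n \<omega>) \<and> (\<Sum>k. \<zeta> (j + k) \<omega>) \<le> ennreal c}" for j
    have [measurable]: "E j \<in> sets M" for j
    proof -
      have "E j = {\<omega>\<in>space M. \<omega> \<in> A j \<and> (\<exists>n\<in>{j..}. ennreal l \<le> Z n \<omega>) \<and> (\<Sum>k. \<zeta> (j + k) \<omega>) \<le> ennreal c}"
        unfolding E_def using sets.sets_into_space[of "A j" M] by auto
      also have "\<dots> \<in> sets M" by measurable
      finally show ?thesis .
    qed
    have "B m \<subseteq> (\<Union>j. E j)"
    proof
      fix \<omega> assume \<omega>: "\<omega> \<in> B m"
      define j where "j = (LEAST j. m \<le> j \<and> Z j \<omega> \<le> ennreal c)"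
      have j: "m \<le> j \<and> Z j \<omega> \<le> ennreal c"
        unfolding j_def by (rule LeastI_ex) (use \<omega> in \<open>auto simp: B_def\<close>)
      have "\<not> Z i \<omega> \<le> ennreal c" if "m \<le> i" "i < j" for i
        using not_less_Least[of i "\<lambda>j. m \<le> j \<and> Z j \<omega> \<le> ennreal c"] that by (auto simp: j_def)
      then have "\<omega> \<in> A j"
        using j \<omega> by (auto simp: A_def B_def)
      moreover have "(\<Sum>k. \<zeta> (j + k) \<omega>) \<le> ennreal c"
        using order_trans[OF tail[of m j "\<lambda>k. \<zeta> k \<omega>"]] j \<omega> by (auto simp: B_def add.commute)
      ultimately have "\<omega> \<in> E j"
        using \<omega> by (auto simp: E_def B_def)
      then show "\<omega> \<in> (\<Union>j. E j)" by blast
    qed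
    then have "emeasure M (B m) \<le> emeasure M (\<Union>j. E j)"
      by (intro emeasure_mono) auto
    also have "\<dots> \<le> (\<Sum>j. emeasure M (E j))"
      by (rule emeasure_subadditive_countably) auto
    finally have "ennreal l * emeasure M (B m) \<le> ennreal l * (\<Sum>j. emeasure M (E j))"
      by (rule mult_left_mono) simp
    also have "\<dots> = (\<Sum>j. ennreal l * emeasure M (E j))"
      by simp
    also have "\<dots> \<le> (\<Sum>j. ennreal (2 * c) * emeasure M (A j))"
    proof (rule suminf_le)
      fix j
      show "ennreal l * emeasure M (E j) \<le> ennreal (2 * c) * emeasure M (A j)"
        unfolding E_def
        by (rule maximal_inequality_after[OF Z \<zeta> drift AF _ c]) (auto simp: A_def split: if_splits)
    qed auto
    also have "\<dots> = ennreal (2 * c) * (\<Sum>j. emeasure M (A j))"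
      by simp
    also have "(\<Sum>j. emeasure M (A j)) = emeasure M (\<Union>j. A j)"
      by (rule suminf_emeasure) (use disj in auto)
    also have "ennreal (2 * c) * emeasure M (\<Union>j. A j) \<le> ennreal (2 * c) * 1"
      by (intro mult_left_mono emeasure_le_1) simp
    finally show ?thesis by simp
  qed
  have "?L \<subseteq> (\<Union>m. B m)"
    using ennreal_suminf_tail_le[OF _ c(1)] by (auto simp: B_def)
  then have "ennreal l * emeasure M ?L \<le> ennreal l * emeasure M (\<Union>m. B m)"
    by (intro mult_left_mono emeasure_mono) auto
  also have "\<dots> = ennreal l * (SUP m. emeasure M (B m))"
    using \<open>incseq B\<close> by (subst SUP_emeasure_incseq) auto
  also have "\<dots> = (SUP m. ennreal l * emeasure M (B m))"
    by (simp add: SUP_mult_left_ennreal)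
  also have "\<dots> \<le> ennreal (2 * c)"
    by (rule SUP_least) (rule B_le)
  finally show ?thesis .
qed

section \<open>Almost sure convergence to zero\<close>

text \<open>By the maximal inequality the event that \<open>l\<close> is reached infinitely often
  has probability at most \<open>2 * c / l\<close> for every positive \<open>c < l\<close>, hence
  probability 0.\<close>

lemma AE_eventually_less_of_frequently_small:
  fixes Z \<zeta> :: "nat \<Rightarrow> 'a \<Rightarrow> ennreal" and l :: real
  assumes Z: "\<And>n. Z n \<in> borel_measurable (F n)"
    and \<zeta>: "\<And>n. \<zeta> n \<in> borel_measurable (F n)"
    and drift: "\<And>n. AE \<omega> in M. Z n \<omega> < ennreal l \<longrightarrow>
                  nn_cond_exp M (F n) (Z (Suc n)) \<omega> \<le> Z n \<omega> + \<zeta> n \<omega>"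
    and fin: "AE \<omega> in M. (\<Sum>k. \<zeta> k \<omega>) < \<infinity>"
    and small: "AE \<omega> in M. \<forall>c>0. \<forall>m. \<exists>n\<ge>m. Z n \<omega> \<le> ennreal c"
    and l: "0 < l"
  shows "AE \<omega> in M. eventually (\<lambda>n. Z n \<omega> < ennreal l) sequentially"
proof -
  have [measurable]: "Z n \<in> borel_measurable M" "\<zeta> n \<in> borel_measurable M" for n
    using measurable_F_imp_M Z \<zeta> by blast+
  define E where "E = {\<omega>\<in>space M. \<forall>m. \<exists>n\<ge>m. ennreal l \<le> Z n \<omega>}"
  have [measurable]: "E \<in> sets M"
    unfolding E_def by measurable
  have le: "l * measure M E \<le> 2 * c" if c: "0 < c" "c < l" for c
  proof -
    \<comment> \<open>The conditions added to \<open>E\<close> hold almost surely and do not change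
      its measure.\<close>
    have "emeasure M E = emeasure M {\<omega>\<in>space M. (\<forall>m. \<exists>n\<ge>m. ennreal l \<le> Z n \<omega>) \<and>
             (\<forall>m. \<exists>n\<ge>m. Z n \<omega> \<le> ennreal c) \<and> (\<Sum>k. \<zeta> k \<omega>) < \<infinity>}"
    proof (rule emeasure_eq_AE)
      show "AE \<omega> in M. (\<omega> \<in> E) = (\<omega> \<in> {\<omega>\<in>space M. (\<forall>m. \<exists>n\<ge>m. ennreal l \<le> Z n \<omega>) \<and>
             (\<forall>m. \<exists>n\<ge>m. Z n \<omega> \<le> ennreal c) \<and> (\<Sum>k. \<zeta> k \<omega>) < \<infinity>})"
        using fin small by eventually_elim (use c in \<open>auto simp: E_def\<close>)
    qed measurable
    then have "ennreal l * emeasure M E \<le> ennreal (2 * c)"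
      using maximal_inequality_frequently_small[OF Z \<zeta> drift c] by simp
    then show ?thesis
      using l c by (simp add: emeasure_eq_measure flip: ennreal_mult)
  qed
  have "measure M E = 0"
  proof (rule ccontr)
    assume "measure M E \<noteq> 0"
    then have pos: "0 < l * measure M E"
      using l by (simp add: zero_less_measure_iff)
    have "l * measure M E \<le> l * 1"
      using l by (intro mult_left_mono) auto
    \<comment> \<open>The value \<open>c = l * measure M E / 4\<close> is admissible and bounds a
      positive number by half of itself.\<close>
    then have "l * measure M E / 4 < l"
      using l by linarith
    then have "l * measure M E \<le> 2 * (l * measure M E / 4)"
      using pos by (intro le) simp_all
    then show False
      using pos by linarith
  qed
  then have "E \<in> null_sets M"
    by (auto simp: emeasure_eq_measure)
  then have "AE \<omega> in M. \<omega> \<notin> E"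
    by (rule AE_not_in)
  with AE_space show ?thesis
  proof eventually_elim
    case (elim \<omega>)
    then show ?case
      unfolding E_def eventually_sequentially by (auto simp: not_le) (meson not_le)
  qed
qed

text \<open>
  The idea is to restrict the \<open>n\<close>-th term to the \<open>F n\<close>-measurable event that the conditional
  expectations up to time \<open>n\<close> sum up to at most \<open>K\<close>: the restricted series has expectation at most \<open>K\<close>.
\<close>

lemma AE_suminf_finite_of_cond_exp:
  fixes X :: "nat \<Rightarrow> 'a \<Rightarrow> ennreal"
  assumes X: "\<And>n. X n \<in> borel_measurable M"
    and fin: "AE \<omega> in M. (\<Sum>n. nn_cond_exp M (F n) (X n) \<omega>) < \<infinity>"
  shows "AE \<omega> in M. (\<Sum>n. X n \<omega>) < \<infinity>"
proof -
  define \<eta> where "\<eta> n = nn_cond_exp M (F n) (X n)" for n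
  have \<eta>F: "\<eta> n \<in> borel_measurable (F n)" for n
    by (simp add: \<eta>_def)
  have [measurable]: "X n \<in> borel_measurable M" "\<eta> n \<in> borel_measurable M" for n
    using X measurable_F_imp_M[OF \<eta>F] by auto
  have fin': "AE \<omega> in M. (\<Sum>n. \<eta> n \<omega>) < \<infinity>"
    using fin by (simp add: \<eta>_def)
  have "AE \<omega> in M. (\<Sum>k. \<eta> k \<omega>) \<le> of_nat K \<longrightarrow> (\<Sum>n. X n \<omega>) < \<infinity>" for K :: nat
  proof -
    define G where "G n = {\<omega>\<in>space M. (\<Sum>k\<in>{..n}. \<eta> k \<omega>) \<le> of_nat K}" for n
    have GF: "G n \<in> sets (F n)" for n
    proof -
      have [measurable]: "\<eta> k \<in> borel_measurable (F n)" if "k \<le> n" for k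
        using that by (rule measurable_F_mono[OF \<eta>F])
      have "{\<omega>\<in>space (F n). (\<Sum>k\<in>{..n}. \<eta> k \<omega>) \<le> of_nat K} \<in> sets (F n)"
        by measurable
      then show ?thesis by (simp add: G_def space_F)
    qed
    then have [measurable]: "G n \<in> sets M" for n
      using sets_F_imp_M by blast
    have "(\<integral>\<^sup>+\<omega>. (\<Sum>n. indicator (G n) \<omega> * X n \<omega>) \<partial>M) = (\<Sum>n. \<integral>\<^sup>+\<omega>. indicator (G n) \<omega> * X n \<omega> \<partial>M)"
      by (rule nn_integral_suminf) auto
    \<comment> \<open>\<open>G n\<close> is known at time \<open>n\<close>, so under the integral
      \<open>X n\<close> may be exchanged for its conditional expectation.\<close>
    also have "\<dots> = (\<Sum>n. \<integral>\<^sup>+\<omega>. indicator (G n) \<omega> * \<eta> n \<omega> \<partial>M)"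
    proof (rule suminf_cong)
      fix n
      interpret sigma_finite_subalgebra M "F n"
        by (rule sigma_finite_F)
      show "(\<integral>\<^sup>+\<omega>. indicator (G n) \<omega> * X n \<omega> \<partial>M) = (\<integral>\<^sup>+\<omega>. indicator (G n) \<omega> * \<eta> n \<omega> \<partial>M)"
        unfolding \<eta>_def using GF by (intro nn_cond_exp_intg[symmetric]) auto
    qed
    also have "\<dots> = (\<integral>\<^sup>+\<omega>. (\<Sum>n. indicator (G n) \<omega> * \<eta> n \<omega>) \<partial>M)"
      by (rule nn_integral_suminf[symmetric]) auto
    also have "\<dots> \<le> (\<integral>\<^sup>+\<omega>. of_nat K \<partial>M)"
    proof (rule nn_integral_mono, rule suminf_le_const)
      fix \<omega> N
      \<comment> \<open>Membership in \<open>G\<close> at the largest index of \<open>I\<close>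
        bounds all selected terms together by \<open>K\<close>.\<close>
      define I where "I = {n. n < N \<and> \<omega> \<in> G n}"
      have eq: "(\<Sum>n<N. indicator (G n) \<omega> * \<eta> n \<omega>) = (\<Sum>n\<in>I. \<eta> n \<omega>)"
        unfolding I_def by (intro sum.mono_neutral_cong_right) (auto simp: indicator_def)
      show "(\<Sum>n<N. indicator (G n) \<omega> * \<eta> n \<omega>) \<le> of_nat K"
      proof (cases "I = {}")
        case False
        have fI: "finite I" by (auto simp: I_def)
        have "\<omega> \<in> G (Max I)"
          using Max_in[OF fI False] unfolding I_def by blast
        then have "(\<Sum>n\<le>Max I. \<eta> n \<omega>) \<le> of_nat K"
          unfolding G_def by blast
        moreover have "(\<Sum>n\<in>I. \<eta> n \<omega>) \<le> (\<Sum>n\<le>Max I. \<eta> n \<omega>)"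
          using fI by (intro sum_mono2) auto
        ultimately show ?thesis by (simp add: eq)
      qed (simp add: eq)
    qed simp
    also have "\<dots> < \<infinity>"
      by (simp add: emeasure_space_1 of_nat_less_top)
    finally have "AE \<omega> in M. (\<Sum>n. indicator (G n) \<omega> * X n \<omega>) \<noteq> \<infinity>"
      by (intro nn_integral_noteq_infinite) auto
    then show ?thesis
    proof (rule AE_mp, intro AE_I2 impI)
      fix \<omega> assume \<omega>: "\<omega> \<in> space M" "(\<Sum>n. indicator (G n) \<omega> * X n \<omega>) \<noteq> \<infinity>"
        and K: "(\<Sum>k. \<eta> k \<omega>) \<le> of_nat K"
      \<comment> \<open>Where the whole series of \<open>\<eta>\<close> is at most \<open>K\<close>,
        the restriction to \<open>G n\<close> removes nothing.\<close>
      have "\<omega> \<in> G n" for n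
        using \<omega> order_trans[OF sum_le_suminf K] by (auto simp: G_def)
      then show "(\<Sum>n. X n \<omega>) < \<infinity>"
        using \<omega> by (simp add: less_top)
    qed
  qed
  then have "AE \<omega> in M. \<forall>K::nat. (\<Sum>k. \<eta> k \<omega>) \<le> of_nat K \<longrightarrow> (\<Sum>n. X n \<omega>) < \<infinity>"
    by (subst AE_all_countable) blast
  with fin' show ?thesis
  proof eventually_elim
    case (elim \<omega>)
    then obtain K :: nat where "(\<Sum>k. \<eta> k \<omega>) < of_nat K"
      using ennreal_Ex_less_of_nat by (auto simp: less_top)
    with elim show ?case by (auto intro: less_imp_le)
  qed
qed

text \<open>For each level \<open>l\<close> the perturbation \<open>l * D n + E n\<close> is
  summable and dominates the drift as long as \<open>Z n\<close> is below \<open>l\<close>, so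
  \<open>Z n\<close> is eventually below \<open>l\<close>. The countably many levels
  \<open>1 / (k + 1)\<close> give the limit outside one null set.\<close>

lemma almost_supermartingale_tendsto_0:
  fixes Z :: "nat \<Rightarrow> 'a \<Rightarrow> real" and D E :: "nat \<Rightarrow> 'a \<Rightarrow> ennreal"
  assumes Z: "\<And>n. Z n \<in> borel_measurable (F n)"
    and D: "\<And>n. D n \<in> borel_measurable (F n)"
    and E: "\<And>n. E n \<in> borel_measurable (F n)"
    and nonneg: "\<And>n \<omega>. \<omega> \<in> space M \<Longrightarrow> 0 \<le> Z n \<omega>"
    and drift: "\<And>n. AE \<omega> in M. nn_cond_exp M (F n) (\<lambda>\<omega>'. ennreal (Z (Suc n) \<omega>')) \<omega>
                  \<le> (1 + D n \<omega>) * ennreal (Z n \<omega>) + E n \<omega>"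
    and D_fin: "AE \<omega> in M. (\<Sum>n. D n \<omega>) < \<infinity>"
    and E_fin: "AE \<omega> in M. (\<Sum>n. E n \<omega>) < \<infinity>"
    and small: "AE \<omega> in M. \<forall>c>0. \<forall>m. \<exists>n\<ge>m. Z n \<omega> \<le> c"
  shows "AE \<omega> in M. (\<lambda>n. Z n \<omega>) \<longlonglongrightarrow> 0"
proof -
  have ev: "AE \<omega> in M. eventually (\<lambda>n. ennreal (Z n \<omega>) < ennreal l) sequentially" if l: "0 < l" for l
  proof (rule AE_eventually_less_of_frequently_small[where \<zeta>="\<lambda>n \<omega>. ennreal l * D n \<omega> + E n \<omega>"])
    show "(\<lambda>\<omega>. ennreal (Z n \<omega>)) \<in> borel_measurable (F n)"
      "(\<lambda>\<omega>. ennreal l * D n \<omega> + E n \<omega>) \<in> borel_measurable (F n)" for n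
      using Z[of n] D[of n] E[of n] by measurable
    show "AE \<omega> in M. ennreal (Z n \<omega>) < ennreal l \<longrightarrow>
        nn_cond_exp M (F n) (\<lambda>\<omega>. ennreal (Z (Suc n) \<omega>)) \<omega>
          \<le> ennreal (Z n \<omega>) + (ennreal l * D n \<omega> + E n \<omega>)" for n
      using drift[of n]
    proof (rule AE_mp, intro AE_I2 impI)
      fix \<omega>
      assume "nn_cond_exp M (F n) (\<lambda>\<omega>. ennreal (Z (Suc n) \<omega>)) \<omega> \<le> (1 + D n \<omega>) * ennreal (Z n \<omega>) + E n \<omega>"
        and less: "ennreal (Z n \<omega>) < ennreal l"
      note this(1)
      also have "(1 + D n \<omega>) * ennreal (Z n \<omega>) + E n \<omega>
          = ennreal (Z n \<omega>) + (ennreal (Z n \<omega>) * D n \<omega> + E n \<omega>)"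
        by (simp add: algebra_simps)
      also have "\<dots> \<le> ennreal (Z n \<omega>) + (ennreal l * D n \<omega> + E n \<omega>)"
        using less by (intro add_left_mono add_right_mono mult_right_mono) auto
      finally show "nn_cond_exp M (F n) (\<lambda>\<omega>. ennreal (Z (Suc n) \<omega>)) \<omega>
          \<le> ennreal (Z n \<omega>) + (ennreal l * D n \<omega> + E n \<omega>)" .
    qed
    show "AE \<omega> in M. (\<Sum>n. ennreal l * D n \<omega> + E n \<omega>) < \<infinity>"
      using D_fin E_fin
      by eventually_elim (auto simp: suminf_add[symmetric] ennreal_mult_less_top)
    show "AE \<omega> in M. \<forall>c>0. \<forall>m. \<exists>n\<ge>m. ennreal (Z n \<omega>) \<le> ennreal c"
      using small by eventually_elim (meson ennreal_leI)
  qed (fact l)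
  have "AE \<omega> in M. \<forall>k. eventually (\<lambda>n. ennreal (Z n \<omega>) < ennreal (inverse (real (Suc k)))) sequentially"
    unfolding AE_all_countable by (intro allI ev) simp
  with AE_space show ?thesis
  proof eventually_elim
    case (elim \<omega>)
    show ?case
    proof (rule LIMSEQ_I)
      fix r :: real assume "0 < r"
      then obtain k where k: "inverse (real (Suc k)) < r"
        using reals_Archimedean by blast
      have "eventually (\<lambda>n. ennreal (Z n \<omega>) < ennreal (inverse (real (Suc k)))) sequentially"
        using elim by blast
      then show "\<exists>no. \<forall>n\<ge>no. norm (Z n \<omega> - 0) < r"
        unfolding eventually_sequentially
        using k nonneg[OF elim(1)] by (fastforce simp: ennreal_less_iff)
    qed
  qed
qed

end

section \<open>Rates of convergence in the three cases\<close>

theorem theorem1p4: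
  fixes M :: "'a measure"
    and F :: "nat \<Rightarrow> 'a measure"
    and \<alpha> \<theta> \<xi> \<delta> \<epsilon> :: "nat \<Rightarrow> 'a \<Rightarrow> real"
  assumes "prob_space M" and "complete_measure M"
    and "filtration (space M) F" and "\<And>n. subalgebra M (F n)"
    and "\<And>n. \<alpha> n \<in> borel_measurable (F n)"
    and "\<And>n \<omega>. \<omega> \<in> space M \<Longrightarrow> 0 < \<alpha> n \<omega>"
    and "AE \<omega> in M. (\<Sum>n. ennreal (\<alpha> n \<omega>)) = \<infinity>"
    and "\<And>n \<omega>. \<theta> n \<omega> = (\<Sum>k\<le>n. \<alpha> k \<omega>)"
    and "\<And>n. \<xi> n \<in> borel_measurable (F n)"
    and "\<And>n \<omega>. \<omega> \<in> space M \<Longrightarrow> 0 \<le> \<xi> n \<omega>"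
    and "\<And>n. \<delta> n \<in> borel_measurable (F n)"
    and "\<And>n \<omega>. \<omega> \<in> space M \<Longrightarrow> 0 \<le> \<delta> n \<omega>"
    and "\<And>n. \<epsilon> n \<in> borel_measurable (F n)"
    and "\<And>n \<omega>. \<omega> \<in> space M \<Longrightarrow> 0 \<le> \<epsilon> n \<omega>"
    and "AE \<omega> in M. (\<Sum>n. ennreal (\<delta> n \<omega>)) < \<infinity>"
    and "\<And>n. AE \<omega> in M. nn_cond_exp M (F n) (\<lambda>\<omega>'. ennreal (\<xi> (Suc n) \<omega>')) \<omega>
               \<le> ennreal ((1 + \<delta> n \<omega>) * \<xi> n \<omega> + \<epsilon> n \<omega>)"
    and "AE \<omega> in M. (\<Sum>n. ennreal (\<theta> n \<omega> * \<epsilon> n \<omega>)) < \<infinity>"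
  shows
    "((AE \<omega> in M. (\<Sum>n. ennreal (\<alpha> n \<omega> * \<xi> n \<omega>)) < \<infinity>)
        \<longrightarrow> ae_little_o_inverse M (\<lambda>n. \<xi> (Suc n)) \<theta>)
     \<and>
     ((AE \<omega> in M. (\<Sum>n. nn_cond_exp M (F n)
                      (\<lambda>\<omega>'. ennreal (\<alpha> (Suc n) \<omega>' * \<xi> (Suc n) \<omega>')) \<omega>) < \<infinity>)
        \<longrightarrow> ae_little_o_inverse M \<xi> \<theta>)
     \<and>
     ((\<Sum>n. \<integral>\<^sup>+\<omega>. ennreal (\<theta> n \<omega> * \<epsilon> n \<omega>) \<partial>M) < \<infinity>
        \<and> (\<Sum>n. \<integral>\<^sup>+\<omega>. ennreal (\<alpha> n \<omega> * \<xi> n \<omega>) \<partial>M) < \<infinity>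
        \<and> (\<Sum>n. \<integral>\<^sup>+\<omega>. ennreal (\<delta> n \<omega>) \<partial>M) < \<infinity>
        \<and> (\<forall>n. indep_rv M borel (\<delta> n) (borel \<Otimes>\<^sub>M borel) (\<lambda>\<omega>. (\<xi> n \<omega>, \<theta> n \<omega>)))
        \<longrightarrow> ae_little_o_inverse M \<xi> \<theta>
            \<and> (\<lambda>n. \<integral>\<^sup>+\<omega>. ennreal (sqrt (\<xi> n \<omega> * \<theta> n \<omega>)) \<partial>M) \<longlonglongrightarrow> 0)"
proof -
  interpret filtered_prob_space M F
    by (intro filtered_prob_space.intro filtered_prob_space_axioms.intro assms(1,3,4))
  note \<alpha>F[measurable] = assms(5) and \<alpha>_pos = assms(6) and \<theta>_def = assms(8)
    and \<xi>F = assms(9) and \<xi>_nonneg = assms(10)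
    and \<delta>F[measurable] = assms(11) and \<delta>_nonneg = assms(12)
    and \<epsilon>F[measurable] = assms(13) and \<epsilon>_nonneg = assms(14)
  have \<theta>F[measurable]: "\<theta> n \<in> borel_measurable (F n)" for n
  proof -
    have [measurable]: "\<alpha> k \<in> borel_measurable (F n)" if "k \<le> n" for k
      using that by (rule measurable_F_mono[OF \<alpha>F])
    have "(\<lambda>\<omega>. \<Sum>k\<in>{..n}. \<alpha> k \<omega>) \<in> borel_measurable (F n)"
      by measurable
    then show ?thesis by (simp add: \<theta>_def[abs_def])
  qed
  have \<theta>_nonneg: "0 \<le> \<theta> n \<omega>" if "\<omega> \<in> space M" for n \<omega>
    unfolding \<theta>_def using \<alpha>_pos[OF that] by (intro sum_nonneg) (auto intro: less_imp_le)
  have M_meas[measurable]: "\<alpha> n \<in> borel_measurable M" "\<theta> n \<in> borel_measurable M" "\<xi> n \<in> borel_measurable M"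
    "\<delta> n \<in> borel_measurable M" "\<epsilon> n \<in> borel_measurable M" for n
    using measurable_F_imp_M \<alpha>F \<theta>F \<xi>F \<delta>F \<epsilon>F by blast+
  define \<eta> where "\<eta> n = nn_cond_exp M (F n) (\<lambda>\<omega>'. ennreal (\<alpha> (Suc n) \<omega>' * \<xi> (Suc n) \<omega>'))" for n
  have \<eta>F[measurable]: "\<eta> n \<in> borel_measurable (F n)" for n
    by (simp add: \<eta>_def)

  \<comment> \<open>The Abel--Dini argument, applied pathwise.\<close>
  have small: "AE \<omega> in M. \<forall>c>0. \<forall>m. \<exists>n\<ge>m. \<theta> n \<omega> * \<xi> n \<omega> \<le> c"
    if "AE \<omega> in M. (\<Sum>n. ennreal (\<alpha> n \<omega> * \<xi> n \<omega>)) < \<infinity>"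
    using that assms(7) AE_space
    by eventually_elim
      (use weighted_sum_finite_imp_frequently_small \<alpha>_pos \<xi>_nonneg in \<open>simp add: \<theta>_def\<close>)

  \<comment> \<open>\<open>\<theta> n\<close> is known at time \<open>n\<close> and can be pulled
    out of the conditional expectation; multiplying the assumed inequality by it turns
    \<open>\<epsilon> n\<close> into \<open>\<theta> n * \<epsilon> n\<close>.\<close>
  have cond_\<theta>: "AE \<omega> in M. nn_cond_exp M (F n) (\<lambda>\<omega>'. ennreal (\<theta> n \<omega>' * \<xi> (Suc n) \<omega>')) \<omega>
      \<le> (1 + ennreal (\<delta> n \<omega>)) * ennreal (\<theta> n \<omega> * \<xi> n \<omega>) + ennreal (\<theta> n \<omega> * \<epsilon> n \<omega>)" for n
  proof -
    interpret sigma_finite_subalgebra M "F n"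
      by (rule sigma_finite_F)
    have "AE \<omega> in M. nn_cond_exp M (F n) (\<lambda>\<omega>'. ennreal (\<theta> n \<omega>') * ennreal (\<xi> (Suc n) \<omega>')) \<omega>
        = nn_cond_exp M (F n) (\<lambda>\<omega>'. ennreal (\<theta> n \<omega>' * \<xi> (Suc n) \<omega>')) \<omega>"
      by (rule nn_cond_exp_cong) (auto intro!: AE_I2 simp: ennreal_mult \<theta>_nonneg \<xi>_nonneg)
    moreover have "AE \<omega> in M. ennreal (\<theta> n \<omega>) * nn_cond_exp M (F n) (\<lambda>\<omega>'. ennreal (\<xi> (Suc n) \<omega>')) \<omega>
        = nn_cond_exp M (F n) (\<lambda>\<omega>'. ennreal (\<theta> n \<omega>') * ennreal (\<xi> (Suc n) \<omega>')) \<omega>"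
      by (rule nn_cond_exp_prod) auto
    ultimately show ?thesis
      using assms(16)[of n] AE_space
    proof eventually_elim
      case (elim \<omega>)
      have nn: "0 \<le> \<theta> n \<omega>" "0 \<le> \<xi> n \<omega>" "0 \<le> \<delta> n \<omega>" "0 \<le> \<epsilon> n \<omega>"
        using elim(4) \<theta>_nonneg \<xi>_nonneg \<delta>_nonneg \<epsilon>_nonneg by auto
      have "ennreal (\<theta> n \<omega>) * nn_cond_exp M (F n) (\<lambda>\<omega>'. ennreal (\<xi> (Suc n) \<omega>')) \<omega>
          \<le> ennreal (\<theta> n \<omega>) * ennreal ((1 + \<delta> n \<omega>) * \<xi> n \<omega> + \<epsilon> n \<omega>)"
        by (intro mult_left_mono elim(3)) simp
      also have "\<dots> = (1 + ennreal (\<delta> n \<omega>)) * ennreal (\<theta> n \<omega> * \<xi> n \<omega>) + ennreal (\<theta> n \<omega> * \<epsilon> n \<omega>)"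
        using nn by (simp add: ennreal_mult algebra_simps)
      finally show ?case
        using elim(1,2) by simp
    qed
  qed

  have part1: "AE \<omega> in M. (\<lambda>n. \<xi> (Suc n) \<omega> * \<theta> n \<omega>) \<longlonglongrightarrow> 0"
    if fin: "AE \<omega> in M. (\<Sum>n. ennreal (\<alpha> n \<omega> * \<xi> n \<omega>)) < \<infinity>"
  proof -
    \<comment> \<open>The sum stops before \<open>n\<close>, so the weight of
      \<open>\<xi> (Suc n)\<close> in \<open>Z (Suc n)\<close> is \<open>\<theta> n\<close>, already
      known at time \<open>n\<close>. This is the index shift in the claim.\<close>
    define Z where "Z n \<omega> = (\<Sum>k<n. \<alpha> k \<omega>) * \<xi> n \<omega>" for n \<omega>
    have Z_Suc: "Z (Suc n) \<omega> = \<theta> n \<omega> * \<xi> (Suc n) \<omega>" for n \<omega>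
      unfolding Z_def \<theta>_def lessThan_Suc_atMost ..
    \<comment> \<open>Passing from the weight \<open>\<theta> n\<close> to the weight in
      \<open>Z n\<close> costs \<open>\<alpha> n * \<xi> n\<close>, which is summable and goes into
      the additive perturbation.\<close>
    have Z_add: "\<theta> n \<omega> * \<xi> n \<omega> = Z n \<omega> + \<alpha> n \<omega> * \<xi> n \<omega>" for n \<omega>
      by (simp add: Z_def \<theta>_def algebra_simps flip: lessThan_Suc_atMost)
    have Z_nonneg: "0 \<le> Z n \<omega>" if "\<omega> \<in> space M" for n \<omega>
      unfolding Z_def using \<alpha>_pos[OF that] \<xi>_nonneg[OF that]
      by (intro mult_nonneg_nonneg sum_nonneg) (auto intro: less_imp_le)
    have "AE \<omega> in M. (\<lambda>n. Z n \<omega>) \<longlonglongrightarrow> 0"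
    proof (rule almost_supermartingale_tendsto_0[where D="\<lambda>n \<omega>. ennreal (\<delta> n \<omega>)"
          and E="\<lambda>n \<omega>. (1 + ennreal (\<delta> n \<omega>)) * ennreal (\<alpha> n \<omega> * \<xi> n \<omega>) + ennreal (\<theta> n \<omega> * \<epsilon> n \<omega>)"])
      fix n
      have [measurable]: "\<alpha> k \<in> borel_measurable (F n)" if "k \<in> {..<n}" for k
        using that by (intro measurable_F_mono[OF \<alpha>F]) auto
      note \<xi>F[measurable]
      show "Z n \<in> borel_measurable (F n)"
        unfolding Z_def[abs_def] by measurable
      show "(\<lambda>\<omega>. ennreal (\<delta> n \<omega>)) \<in> borel_measurable (F n)"
        "(\<lambda>\<omega>. (1 + ennreal (\<delta> n \<omega>)) * ennreal (\<alpha> n \<omega> * \<xi> n \<omega>) + ennreal (\<theta> n \<omega> * \<epsilon> n \<omega>))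
          \<in> borel_measurable (F n)"
        by measurable
      show "AE \<omega> in M. nn_cond_exp M (F n) (\<lambda>\<omega>'. ennreal (Z (Suc n) \<omega>')) \<omega>
          \<le> (1 + ennreal (\<delta> n \<omega>)) * ennreal (Z n \<omega>)
            + ((1 + ennreal (\<delta> n \<omega>)) * ennreal (\<alpha> n \<omega> * \<xi> n \<omega>) + ennreal (\<theta> n \<omega> * \<epsilon> n \<omega>))"
        using cond_\<theta>[of n] AE_space
      proof eventually_elim
        case (elim \<omega>)
        have "ennreal (\<theta> n \<omega> * \<xi> n \<omega>) = ennreal (Z n \<omega>) + ennreal (\<alpha> n \<omega> * \<xi> n \<omega>)"
          unfolding Z_add using Z_nonneg[OF elim(2)] \<alpha>_pos[OF elim(2)] \<xi>_nonneg[OF elim(2)]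
          by (intro ennreal_plus mult_nonneg_nonneg) (auto intro: less_imp_le)
        then show ?case
          using elim(1) by (simp add: Z_Suc algebra_simps)
      qed
    next
      show "AE \<omega> in M. (\<Sum>n. (1 + ennreal (\<delta> n \<omega>)) * ennreal (\<alpha> n \<omega> * \<xi> n \<omega>)
          + ennreal (\<theta> n \<omega> * \<epsilon> n \<omega>)) < \<infinity>"
        using fin assms(15,17)
      proof eventually_elim
        case (elim \<omega>)
        \<comment> \<open>Each \<open>\<delta> n\<close> is at most its finite total, so the factors
          \<open>1 + \<delta> n\<close> preserve summability.\<close>
        let ?d = "\<Sum>k. ennreal (\<delta> k \<omega>)"
        have "(\<Sum>n. (1 + ennreal (\<delta> n \<omega>)) * ennreal (\<alpha> n \<omega> * \<xi> n \<omega>))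
            \<le> (\<Sum>n. (1 + ?d) * ennreal (\<alpha> n \<omega> * \<xi> n \<omega>))"
        proof (rule suminf_le)
          fix n
          have "ennreal (\<delta> n \<omega>) \<le> ?d"
            using sum_le_suminf[of "\<lambda>k. ennreal (\<delta> k \<omega>)" "{n}"] by simp
          then show "(1 + ennreal (\<delta> n \<omega>)) * ennreal (\<alpha> n \<omega> * \<xi> n \<omega>)
              \<le> (1 + ?d) * ennreal (\<alpha> n \<omega> * \<xi> n \<omega>)"
            by (intro mult_right_mono add_left_mono) auto
        qed auto
        also have "\<dots> < \<infinity>"
          using elim by (simp add: ennreal_mult_less_top)
        finally show ?case
          using elim by (simp add: suminf_add[symmetric])
      qed
      show "AE \<omega> in M. \<forall>c>0. \<forall>m. \<exists>n\<ge>m. Z n \<omega> \<le> c"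
        using small[OF fin] AE_space
      proof eventually_elim
        case (elim \<omega>)
        \<comment> \<open>\<open>Z n\<close> lies below \<open>\<theta> n * \<xi> n\<close> and
          inherits its small values.\<close>
        have "Z n \<omega> \<le> \<theta> n \<omega> * \<xi> n \<omega>" for n
          unfolding Z_add using \<alpha>_pos[OF elim(2), of n] \<xi>_nonneg[OF elim(2), of n] by simp
        then show ?case using elim(1) by (meson order_trans)
      qed
    qed (use Z_nonneg assms(15) in auto)
    then show ?thesis
    proof eventually_elim
      case (elim \<omega>)
      then have "(\<lambda>n. Z (Suc n) \<omega>) \<longlonglongrightarrow> 0"
        by (rule LIMSEQ_Suc)
      then show ?case by (simp add: Z_Suc mult.commute)
    qed
  qed

  \<comment> \<open>Splitting \<open>\<theta> (Suc n)\<close> as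
    \<open>\<theta> n + \<alpha> (Suc n)\<close> reduces to \<open>cond_\<theta>\<close>; the second
    summand contributes exactly \<open>\<eta> n\<close>.\<close>
  have cond_Suc: "AE \<omega> in M. nn_cond_exp M (F n) (\<lambda>\<omega>'. ennreal (\<theta> (Suc n) \<omega>' * \<xi> (Suc n) \<omega>')) \<omega>
      \<le> (1 + ennreal (\<delta> n \<omega>)) * ennreal (\<theta> n \<omega> * \<xi> n \<omega>) + (ennreal (\<theta> n \<omega> * \<epsilon> n \<omega>) + \<eta> n \<omega>)" for n
  proof -
    interpret sigma_finite_subalgebra M "F n"
      by (rule sigma_finite_F)
    have "AE \<omega> in M. nn_cond_exp M (F n) (\<lambda>\<omega>'. ennreal (\<theta> n \<omega>' * \<xi> (Suc n) \<omega>')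
          + ennreal (\<alpha> (Suc n) \<omega>' * \<xi> (Suc n) \<omega>')) \<omega>
        = nn_cond_exp M (F n) (\<lambda>\<omega>'. ennreal (\<theta> (Suc n) \<omega>' * \<xi> (Suc n) \<omega>')) \<omega>"
    proof (rule nn_cond_exp_cong)
      show "AE \<omega> in M. ennreal (\<theta> n \<omega> * \<xi> (Suc n) \<omega>) + ennreal (\<alpha> (Suc n) \<omega> * \<xi> (Suc n) \<omega>)
          = ennreal (\<theta> (Suc n) \<omega> * \<xi> (Suc n) \<omega>)"
      proof (rule AE_I2)
        fix \<omega> assume \<omega>: "\<omega> \<in> space M"
        have "\<theta> (Suc n) \<omega> * \<xi> (Suc n) \<omega> = \<theta> n \<omega> * \<xi> (Suc n) \<omega> + \<alpha> (Suc n) \<omega> * \<xi> (Suc n) \<omega>"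
          by (simp add: \<theta>_def algebra_simps)
        then show "ennreal (\<theta> n \<omega> * \<xi> (Suc n) \<omega>) + ennreal (\<alpha> (Suc n) \<omega> * \<xi> (Suc n) \<omega>)
            = ennreal (\<theta> (Suc n) \<omega> * \<xi> (Suc n) \<omega>)"
          using \<theta>_nonneg[OF \<omega>] \<xi>_nonneg[OF \<omega>] \<alpha>_pos[OF \<omega>]
          by (simp add: less_imp_le flip: ennreal_plus)
      qed
    qed auto
    moreover have "AE \<omega> in M. nn_cond_exp M (F n) (\<lambda>\<omega>'. ennreal (\<theta> n \<omega>' * \<xi> (Suc n) \<omega>')) \<omega> + \<eta> n \<omega>
        = nn_cond_exp M (F n) (\<lambda>\<omega>'. ennreal (\<theta> n \<omega>' * \<xi> (Suc n) \<omega>')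
          + ennreal (\<alpha> (Suc n) \<omega>' * \<xi> (Suc n) \<omega>')) \<omega>"
      unfolding \<eta>_def by (rule nn_cond_exp_sum) auto
    ultimately show ?thesis
      using cond_\<theta>[of n]
    proof eventually_elim
      case (elim \<omega>)
      show ?case
        using add_right_mono[OF elim(3), of "\<eta> n \<omega>"] elim(1,2) by (simp add: add.assoc)
    qed
  qed

  have part2: "AE \<omega> in M. (\<lambda>n. \<xi> n \<omega> * \<theta> n \<omega>) \<longlonglongrightarrow> 0"
    if fin: "AE \<omega> in M. (\<Sum>n. \<eta> n \<omega>) < \<infinity>"
  proof -
    \<comment> \<open>Summable conditional expectations make the series itself finite from index 1
      on; the term at index 0 is finite, so the Abel--Dini argument applies.\<close>
    have "AE \<omega> in M. (\<Sum>n. ennreal (\<alpha> (Suc n) \<omega> * \<xi> (Suc n) \<omega>)) < \<infinity>"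
      by (rule AE_suminf_finite_of_cond_exp[where X="\<lambda>n \<omega>. ennreal (\<alpha> (Suc n) \<omega> * \<xi> (Suc n) \<omega>)"])
        (use fin in \<open>simp_all add: \<eta>_def\<close>)
    then have "AE \<omega> in M. (\<Sum>n. ennreal (\<alpha> n \<omega> * \<xi> n \<omega>)) < \<infinity>"
    proof eventually_elim
      case (elim \<omega>)
      then show ?case
        using suminf_offset[of "\<lambda>n. ennreal (\<alpha> n \<omega> * \<xi> n \<omega>)" 1] by simp
    qed
    note small = small[OF this]
    have "AE \<omega> in M. (\<lambda>n. \<theta> n \<omega> * \<xi> n \<omega>) \<longlonglongrightarrow> 0"
    proof (rule almost_supermartingale_tendsto_0[where D="\<lambda>n \<omega>. ennreal (\<delta> n \<omega>)"
          and E="\<lambda>n \<omega>. ennreal (\<theta> n \<omega> * \<epsilon> n \<omega>) + \<eta> n \<omega>"])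
      fix n
      note \<xi>F[measurable]
      show "(\<lambda>\<omega>. \<theta> n \<omega> * \<xi> n \<omega>) \<in> borel_measurable (F n)"
        "(\<lambda>\<omega>. ennreal (\<delta> n \<omega>)) \<in> borel_measurable (F n)"
        "(\<lambda>\<omega>. ennreal (\<theta> n \<omega> * \<epsilon> n \<omega>) + \<eta> n \<omega>) \<in> borel_measurable (F n)"
        by measurable
    next
      show "AE \<omega> in M. (\<Sum>n. ennreal (\<theta> n \<omega> * \<epsilon> n \<omega>) + \<eta> n \<omega>) < \<infinity>"
        using fin assms(17) by eventually_elim (simp add: suminf_add[symmetric])
    qed (use \<theta>_nonneg \<xi>_nonneg assms(15) small cond_Suc in auto)
    then show ?thesis
      by (simp add: mult.commute)
  qed

  have part3: "(AE \<omega> in M. (\<lambda>n. \<xi> n \<omega> * \<theta> n \<omega>) \<longlonglongrightarrow> 0)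
      \<and> (\<lambda>n. \<integral>\<^sup>+\<omega>. ennreal (sqrt (\<xi> n \<omega> * \<theta> n \<omega>)) \<partial>M) \<longlonglongrightarrow> 0"
    if \<epsilon>_fin: "(\<Sum>n. \<integral>\<^sup>+\<omega>. ennreal (\<theta> n \<omega> * \<epsilon> n \<omega>) \<partial>M) < \<infinity>"
      and \<xi>_fin: "(\<Sum>n. \<integral>\<^sup>+\<omega>. ennreal (\<alpha> n \<omega> * \<xi> n \<omega>) \<partial>M) < \<infinity>"
      and \<delta>_fin: "(\<Sum>n. \<integral>\<^sup>+\<omega>. ennreal (\<delta> n \<omega>) \<partial>M) < \<infinity>"
      and indep: "\<And>n. indep_rv M borel (\<delta> n) (borel \<Otimes>\<^sub>M borel) (\<lambda>\<omega>. (\<xi> n \<omega>, \<theta> n \<omega>))"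
  proof -
    have [measurable]: "\<eta> n \<in> borel_measurable M" for n
      using measurable_F_imp_M[OF \<eta>F] .
    have int_cond: "(\<integral>\<^sup>+\<omega>. nn_cond_exp M (F n) X \<omega> \<partial>M) = (\<integral>\<^sup>+\<omega>. X \<omega> \<partial>M)"
      if [measurable]: "X \<in> borel_measurable M" for X n
    proof -
      interpret sigma_finite_subalgebra M "F n"
        by (rule sigma_finite_F)
      show ?thesis
        using nn_cond_exp_intg[of "\<lambda>_. 1" X] by simp
    qed
    define x where "x n = (\<integral>\<^sup>+\<omega>. ennreal (\<alpha> n \<omega> * \<xi> n \<omega>) \<partial>M)" for n
    have \<eta>_int: "(\<integral>\<^sup>+\<omega>. \<eta> n \<omega> \<partial>M) = x (Suc n)" for n
      unfolding \<eta>_def x_def by (rule int_cond) measurable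
    have x_fin: "x 0 < \<infinity>" "(\<Sum>n. x (Suc n)) < \<infinity>"
      using \<xi>_fin suminf_offset[of x 1] unfolding x_def by auto
    \<comment> \<open>A finite expectation makes the series of \<open>\<eta>\<close> almost surely
      finite, which is the hypothesis of \<open>part2\<close>.\<close>
    have "(\<integral>\<^sup>+\<omega>. (\<Sum>n. \<eta> n \<omega>) \<partial>M) < \<infinity>"
      using x_fin by (simp add: nn_integral_suminf \<eta>_int)
    then have "AE \<omega> in M. (\<Sum>n. \<eta> n \<omega>) \<noteq> \<infinity>"
      by (intro nn_integral_noteq_infinite) auto
    then have lim: "AE \<omega> in M. (\<lambda>n. \<xi> n \<omega> * \<theta> n \<omega>) \<longlonglongrightarrow> 0"
      by (intro part2) (simp add: less_top)
    define p where "p n = (\<integral>\<^sup>+\<omega>. ennreal (\<xi> n \<omega> * \<theta> n \<omega>) \<partial>M)" for n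
    \<comment> \<open>Integrating \<open>cond_Suc\<close> yields an affine recurrence for the
      expectations \<open>p n\<close>.\<close>
    have "\<exists>C\<ge>0. \<forall>n. p n \<le> ennreal C"
    proof (rule ennreal_affine_recurrence_bounded[where d="\<lambda>n. \<integral>\<^sup>+\<omega>. ennreal (\<delta> n \<omega>) \<partial>M"
          and e="\<lambda>n. (\<integral>\<^sup>+\<omega>. ennreal (\<theta> n \<omega> * \<epsilon> n \<omega>) \<partial>M) + x (Suc n)"])
      fix n
      have "p (Suc n) = (\<integral>\<^sup>+\<omega>. nn_cond_exp M (F n) (\<lambda>\<omega>'. ennreal (\<theta> (Suc n) \<omega>' * \<xi> (Suc n) \<omega>')) \<omega> \<partial>M)"
        unfolding p_def by (subst int_cond) (auto simp: mult.commute)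
      also have "\<dots> \<le> (\<integral>\<^sup>+\<omega>. (ennreal (\<xi> n \<omega> * \<theta> n \<omega>) + ennreal (\<delta> n \<omega>) * ennreal (\<xi> n \<omega> * \<theta> n \<omega>))
          + (ennreal (\<theta> n \<omega> * \<epsilon> n \<omega>) + \<eta> n \<omega>) \<partial>M)"
        using cond_Suc[of n] by (intro nn_integral_mono_AE) (simp add: distrib_right mult.commute)
      also have "\<dots> = (p n + (\<integral>\<^sup>+\<omega>. ennreal (\<delta> n \<omega>) * ennreal (\<xi> n \<omega> * \<theta> n \<omega>) \<partial>M))
          + ((\<integral>\<^sup>+\<omega>. ennreal (\<theta> n \<omega> * \<epsilon> n \<omega>) \<partial>M) + x (Suc n))"
        by (simp add: nn_integral_add p_def \<eta>_int)
      \<comment> \<open>Independence enters here: the expectation of the product factors, leaving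
        \<open>p n\<close> with a deterministic summable coefficient.\<close>
      also have "(\<integral>\<^sup>+\<omega>. ennreal (\<delta> n \<omega>) * ennreal (\<xi> n \<omega> * \<theta> n \<omega>) \<partial>M) = (\<integral>\<^sup>+\<omega>. ennreal (\<delta> n \<omega>) \<partial>M) * p n"
        using indep_rv_nn_integral_mult[OF indep[of n], of ennreal "\<lambda>(a, b). ennreal (a * b)"]
        by (simp add: p_def)
      finally show "p (Suc n) \<le> (1 + (\<integral>\<^sup>+\<omega>. ennreal (\<delta> n \<omega>) \<partial>M)) * p n
          + ((\<integral>\<^sup>+\<omega>. ennreal (\<theta> n \<omega> * \<epsilon> n \<omega>) \<partial>M) + x (Suc n))"
        by (simp add: distrib_right)
    next
      \<comment> \<open>Since \<open>\<theta> 0 = \<alpha> 0\<close>, this is the finite term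
        \<open>x 0\<close>.\<close>
      show "p 0 < \<infinity>"
        using x_fin(1) by (simp add: p_def x_def \<theta>_def mult.commute)
      show "(\<Sum>n. (\<integral>\<^sup>+\<omega>. ennreal (\<theta> n \<omega> * \<epsilon> n \<omega>) \<partial>M) + x (Suc n)) < \<infinity>"
        using \<epsilon>_fin x_fin(2) by (simp add: suminf_add[symmetric])
    qed (fact \<delta>_fin)
    then obtain C where "0 \<le> C" "\<And>n. p n \<le> ennreal C"
      by blast
    then have "(\<lambda>n. \<integral>\<^sup>+\<omega>. ennreal (sqrt (\<xi> n \<omega> * \<theta> n \<omega>)) \<partial>M) \<longlonglongrightarrow> 0"
      using lim \<xi>_nonneg \<theta>_nonneg unfolding p_def by (intro nn_integral_sqrt_tendsto_0) auto
    with lim show ?thesis by blast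
  qed
  show ?thesis
    unfolding ae_little_o_inverse_def
    using part1 part2[unfolded \<eta>_def] part3 by blast
qed

end
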